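(* Let $\theta$ be an action of an inverse semigroup $S$ on a locally compact Hausdorff space $X$. For each $e\in E(S)$, the subset $$X^{\mathrm{KS}}_e=\{\tau\in X^{\mathrm{KS}}\mid \tau(e)\neq\infty_e\}$$ is open in $X^{\mathrm{KS}}$, and $X^{\mathrm{KS}}=\bigcup_{e\in E(S)}X^{\mathrm{KS}}_e$. For each $s\in S$, the map $\theta^{\mathrm{KS}}_s\colon X^{\mathrm{KS}}_{s^*s}\to X^{\mathrm{KS}}_{ss^*}$ given, for $\tau\in X^{\mathrm{KS}}_{s^*s}$ and $e\in E(S)$, by $$\theta^{\mathrm{KS}}_s(\tau)(e)=\begin{cases}\theta_{es}(\tau(s^*es)) & \text{if }\tau(s^*es)\neq\infty_{s^*es},\\ \infty_e & \text{otherwise}\end{cases}$$ is a (well-defined) homeomorphism. Moreover, these assignments define an action of $S$ on $X^{\mathrm{KS}}$.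
   Context: An inverse semigroup is a semigroup $S$ in which every $s$ has a unique $s^*$ with $ss^*s=s$, $s^*ss^*=s^*$; $E(S)$ is its commutative subsemigroup of idempotents; $s\le t$ means $ts^*s=s$. An action $\theta$ of $S$ on a topological space $X$ is a semigroup homomorphism $s\mapsto\theta_s$ from $S$ to the inverse semigroup of partial bijections of $X$ (bijections between subsets, composed on the largest possible domain) such that, writing $X_e$ for the subset on which $\theta_e$ ($e\in E(S)$) is the identity (so $\theta_s$ is a bijection $X_{s^*s}\to X_{ss^*}$): each $X_e$ is open, each $\theta_s\colon X_{s^*s}\to X_{ss^*}$ is continuous, and $\bigcup_{e\in E(S)}X_e=X$. The space $X^{\mathrm{KS}}$: for each $e\in E(S)$ let $\widetilde{X_e}=X_e\sqcup\{\infty_e\}$ be the one-point compactification of $X_e$ (a point $\infty_e$ is added even when $X_e$ is compact). Let $\widetilde{X^{\mathrm{KS}}}$ be the set of $\tau\in\prod_{e\in E(S)}\widetilde{X_e}$ such that (1) if $e_1\le e_2$ and $\tau(e_1)\ne\infty_{e_1}$, then $\tau(e_2)=\tau(e_1)$ (as points of $X$); (2) if $\tau(e_1)\neq\infty_{e_1}$ and $\tau(e_2)\neq\infty_{e_2}$, then $\tau(e_1e_2)\neq\infty_{e_1e_2}$. It carries the topology induced from the product topology. Set $X^{\mathrm{KS}}=\widetilde{X^{\mathrm{KS}}}\setminus\{\infty\}$, where $\infty=(\infty_e)_{e\in E(S)}$. *)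

theory Defs
  imports "HOL-Analysis.Analysis"
begin

class inverse_semigroup = semigroup_mult +
  assumes ex1_star: "\<exists>!t. s * t * s = s \<and> t * s * t = t"

definition star :: "'s::inverse_semigroup \<Rightarrow> 's"  (\<open>_\<^sup>\<star>\<close> [1000] 999)
  where "s\<^sup>\<star> = (THE t. s * t * s = s \<and> t * s * t = t)"

definition idempotents :: "'s::inverse_semigroup set"
  where "idempotents = {e. e * e = e}"

definition natural_le :: "'s::inverse_semigroup \<Rightarrow> 's \<Rightarrow> bool"  (infix \<open>\<preceq>\<close> 50)
  where "s \<preceq> t \<longleftrightarrow> t * s\<^sup>\<star> * s = s"

text \<open>A bijection between subsets of \<open>A\<close> is a partial function that is injective on its domain;
  composition on the largest possible domain is then \<open>\<circ>\<^sub>m\<close>.\<close>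

definition partial_bijection :: "'x set \<Rightarrow> ('x \<rightharpoonup> 'x) \<Rightarrow> bool"
  where "partial_bijection A f \<longleftrightarrow> dom f \<subseteq> A \<and> ran f \<subseteq> A \<and> inj_on f (dom f)"

definition act_dom :: "('s::inverse_semigroup \<Rightarrow> ('x \<rightharpoonup> 'x)) \<Rightarrow> 's \<Rightarrow> 'x set"
  where "act_dom \<theta> e = {x. \<theta> e x = Some x}"

text \<open>It follows from the first two conditions that \<open>\<theta> s\<close> has domain \<open>act_dom \<theta> (s\<^sup>\<star> * s)\<close>, so that
  \<open>the\<close> in the continuity condition is only applied to values of the form \<open>Some y\<close>.\<close>

definition is_action :: "'x topology \<Rightarrow> ('s::inverse_semigroup \<Rightarrow> ('x \<rightharpoonup> 'x)) \<Rightarrow> bool"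
  where "is_action X \<theta> \<longleftrightarrow>
    (\<forall>s. partial_bijection (topspace X) (\<theta> s)) \<and>
    (\<forall>s t. \<theta> (s * t) = \<theta> s \<circ>\<^sub>m \<theta> t) \<and>
    (\<forall>e\<in>idempotents. openin X (act_dom \<theta> e)) \<and>
    (\<forall>s. continuous_map (subtopology X (act_dom \<theta> (s\<^sup>\<star> * s)))
                        (subtopology X (act_dom \<theta> (s * s\<^sup>\<star>)))
                        (\<lambda>x. the (\<theta> s x))) \<and>
    (\<Union>e\<in>idempotents. act_dom \<theta> e) = topspace X"

text \<open>In a factor \<open>Alexandroff_compactification (subtopology X (act_dom \<theta> e))\<close> of the product, the
  added point is \<open>None\<close>, and a point \<open>x\<close> of the subspace appears as \<open>Some x\<close>.\<close>

definition KS_product ::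
    "'x topology \<Rightarrow> ('s::inverse_semigroup \<Rightarrow> ('x \<rightharpoonup> 'x)) \<Rightarrow> ('s \<Rightarrow> 'x option) topology"
  where "KS_product X \<theta> =
    product_topology (\<lambda>e. Alexandroff_compactification (subtopology X (act_dom \<theta> e))) idempotents"

definition KS_tilde_set ::
    "'x topology \<Rightarrow> ('s::inverse_semigroup \<Rightarrow> ('x \<rightharpoonup> 'x)) \<Rightarrow> ('s \<Rightarrow> 'x option) set"
  where "KS_tilde_set X \<theta> = {\<tau> \<in> topspace (KS_product X \<theta>).
    (\<forall>e1\<in>idempotents. \<forall>e2\<in>idempotents. e1 \<preceq> e2 \<and> \<tau> e1 \<noteq> None \<longrightarrow> \<tau> e2 = \<tau> e1) \<and>
    (\<forall>e1\<in>idempotents. \<forall>e2\<in>idempotents. \<tau> e1 \<noteq> None \<and> \<tau> e2 \<noteq> None \<longrightarrow> \<tau> (e1 * e2) \<noteq> None)}"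

definition KS_infty :: "'s::inverse_semigroup \<Rightarrow> 'x option"
  where "KS_infty = (\<lambda>e\<in>idempotents. None)"

definition KS_space ::
    "'x topology \<Rightarrow> ('s::inverse_semigroup \<Rightarrow> ('x \<rightharpoonup> 'x)) \<Rightarrow> ('s \<Rightarrow> 'x option) topology"
  where "KS_space X \<theta> = subtopology (KS_product X \<theta>) (KS_tilde_set X \<theta> - {KS_infty})"

definition KS_dom ::
    "'x topology \<Rightarrow> ('s::inverse_semigroup \<Rightarrow> ('x \<rightharpoonup> 'x)) \<Rightarrow> 's \<Rightarrow> ('s \<Rightarrow> 'x option) set"
  where "KS_dom X \<theta> e = {\<tau> \<in> topspace (KS_space X \<theta>). \<tau> e \<noteq> None}"

text \<open>\<open>KS_map \<theta> s\<close> is the formula for the map on \<open>KS_dom X \<theta> (s\<^sup>\<star> * s)\<close>; \<open>KS_act X \<theta> s\<close> is the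
  partial function with exactly that domain. That \<open>\<theta> (e * s)\<close> is defined at \<open>x\<close> in the second
  case is not built in and has to be proved for each \<open>\<tau>\<close> in the domain.\<close>

definition KS_map ::
    "('s::inverse_semigroup \<Rightarrow> ('x \<rightharpoonup> 'x)) \<Rightarrow> 's \<Rightarrow> ('s \<Rightarrow> 'x option) \<Rightarrow> ('s \<Rightarrow> 'x option)"
  where "KS_map \<theta> s \<tau> = (\<lambda>e\<in>idempotents.
    (case \<tau> (s\<^sup>\<star> * e * s) of None \<Rightarrow> None | Some x \<Rightarrow> Some (the (\<theta> (e * s) x))))"

definition KS_act ::
    "'x topology \<Rightarrow> ('s::inverse_semigroup \<Rightarrow> ('x \<rightharpoonup> 'x)) \<Rightarrow> 's \<Rightarrow>
      (('s \<Rightarrow> 'x option) \<rightharpoonup> ('s \<Rightarrow> 'x option))"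
  where "KS_act X \<theta> s = (\<lambda>\<tau>. if \<tau> \<in> KS_dom X \<theta> (s\<^sup>\<star> * s) then Some (KS_map \<theta> s \<tau>) else None)"

end

theory Submission
  imports Defs
begin

text \<open>
  The idea is to describe a point \<open>\<tau>\<close> of the KS space by a pair \<open>(x, F)\<close>. Write \<open>X\<^sub>e\<close> for
  \<open>act_dom \<theta> e\<close>. The finite coordinates of \<open>\<tau>\<close> all equal one point \<open>x\<close> of \<open>X\<close>, and the idempotents at
  which \<open>\<tau>\<close> is finite form a nonempty filter \<open>F\<close> (a product lies in \<open>F\<close> iff both factors do) with
  \<open>x \<in> X\<^sub>e\<close> for all \<open>e \<in> F\<close>; conversely each such pair gives a point
  (\<open>topspace_KS_space\<close>). In these coordinates the formula for the map induced by \<open>s\<close>, defined when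
  \<open>s\<^sup>\<star> s \<in> F\<close>, becomes \<open>(x, F) \<mapsto> (\<theta>\<^sub>s x, {e. s\<^sup>\<star> e s \<in> F})\<close> (\<open>KS_map_point\<close>). Since
  \<open>(s t)\<^sup>\<star> e (s t) = t\<^sup>\<star> (s\<^sup>\<star> e s) t\<close>, these partial maps compose like \<open>S\<close>
  (\<open>KS_act_mult\<close>). As idempotents act as identities, \<open>s\<close> and \<open>s\<^sup>\<star>\<close> induce mutually inverse
  bijections, so that the homeomorphism claim reduces to the continuity of each induced map.

  Continuity is the one place where something can go wrong: the \<open>e\<close>-coordinate of the image of
  \<open>\<tau>\<close> is \<open>\<theta>\<^sub>s\<close> applied to the \<open>s\<^sup>\<star> e s\<close>-coordinate of \<open>\<tau>\<close>, and \<open>\<theta>\<^sub>s\<close> maps the domain of \<open>s\<^sup>\<star> e s\<close> onto the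
  intersection of \<open>X\<^sub>e\<close> with the range of \<open>\<theta>\<^sub>s\<close>, which may be smaller than \<open>X\<^sub>e\<close>. The inclusion of
  an open subset does not in general extend continuously to the one-point compactifications by
  sending \<open>\<infinity>\<close> to \<open>\<infinity>\<close>: the trace on the subset of a compact subset of \<open>X\<^sub>e\<close> is relatively closed but
  perhaps not compact. What saves the argument is that on the domain of the map the
  \<open>s\<^sup>\<star> s\<close>-coordinate is finite and depends continuously on \<open>\<tau>\<close> as a point of \<open>X\<close>. Hence, on this domain,
  the preimage of the trace under \<open>\<theta>\<^sub>s\<close> only has to be relatively closed in the domain of \<open>\<theta>\<^sub>s\<close> for the
  corresponding set of \<open>\<tau>\<close> to be closed; this is \<open>openin_KS_eval_notin_relatively_closed\<close>, and it is
  where local compactness enters.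
\<close>

section \<open>Inverse semigroups\<close>

lemma mult_star_mult: "(s::'s::inverse_semigroup) * s\<^sup>\<star> * s = s"
  and star_mult_star: "(s::'s::inverse_semigroup)\<^sup>\<star> * s * s\<^sup>\<star> = s\<^sup>\<star>"
  using theI'[OF ex1_star[of s]] unfolding star_def by auto

lemma star_unique:
  fixes s :: "'s::inverse_semigroup"
  assumes "s * t * s = s" "t * s * t = t"
  shows "s\<^sup>\<star> = t"
  using assms ex1_star[of s] mult_star_mult[of s] star_mult_star[of s] by blast

lemma star_star [simp]: "((s::'s::inverse_semigroup)\<^sup>\<star>)\<^sup>\<star> = s"
  by (rule star_unique[OF star_mult_star mult_star_mult])

lemma idempotent_star: "e \<in> idempotents \<Longrightarrow> e\<^sup>\<star> = e"
  by (rule star_unique) (auto simp: idempotents_def)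

lemma idempotent_star_mult: "e \<in> idempotents \<Longrightarrow> e\<^sup>\<star> * e = e"
  using idempotent_star by (force simp: idempotents_def)

lemma star_mult_idempotent: "(s::'s::inverse_semigroup)\<^sup>\<star> * s \<in> idempotents"
  by (metis (mono_tags, lifting) idempotents_def mem_Collect_eq mult.assoc star_mult_star)

lemma mult_star_idempotent: "(s::'s::inverse_semigroup) * s\<^sup>\<star> \<in> idempotents"
  using star_mult_idempotent[of "s\<^sup>\<star>"] by simp

text \<open>
  With \<open>x\<close> the inverse of \<open>e f\<close>, the element \<open>f x e\<close> is an inverse of \<open>e f\<close> too. By uniqueness it is
  \<open>x\<close>, which makes \<open>x\<close> idempotent, hence its own inverse, hence equal to \<open>e f\<close>.
\<close>

lemma idempotents_mult:
  fixes e f :: "'s::inverse_semigroup"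
  assumes "e \<in> idempotents" "f \<in> idempotents"
  shows "e * f \<in> idempotents"
proof -
  have ee: "e * e = e" "\<And>a. e * (e * a) = e * a"
    using assms by (simp_all add: idempotents_def flip: mult.assoc)
  have ff: "f * f = f" "\<And>a. f * (f * a) = f * a"
    using assms by (simp_all add: idempotents_def flip: mult.assoc)
  define x where "x = (e * f)\<^sup>\<star>"
  have x1: "e * (f * (x * (e * f))) = e * f" and x2: "x * (e * (f * x)) = x"
    using mult_star_mult[of "e * f"] star_mult_star[of "e * f"]
    by (simp_all add: x_def mult.assoc)
  have x2': "\<And>a. x * (e * (f * (x * a))) = x * a"
    using x2 by (metis mult.assoc)
  have "(e * f)\<^sup>\<star> = f * x * e"
    by (rule star_unique) (simp_all add: mult.assoc ee ff x1 x2')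
  then have "x = f * x * e"
    by (simp add: x_def)
  then have "x * x = x"
    using x2' by (metis mult.assoc)
  then have "x\<^sup>\<star> = x"
    by (simp add: idempotent_star idempotents_def)
  then have "e * f = x"
    by (simp add: x_def)
  with \<open>x * x = x\<close> show ?thesis
    by (simp add: idempotents_def)
qed

text \<open>
  Both products are idempotent, so \<open>f e\<close> and \<open>e f\<close> are both inverses of \<open>e f\<close>.
\<close>

lemma idempotents_commute:
  fixes e f :: "'s::inverse_semigroup"
  assumes "e \<in> idempotents" "f \<in> idempotents"
  shows "e * f = f * e"
proof -
  have ee: "e * e = e" "\<And>a. e * (e * a) = e * a"
    using assms by (simp_all add: idempotents_def flip: mult.assoc)
  have ff: "f * f = f" "\<And>a. f * (f * a) = f * a"
    using assms by (simp_all add: idempotents_def flip: mult.assoc)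
  have efef: "e * (f * (e * f)) = e * f" and fefe: "f * (e * (f * e)) = f * e"
    using idempotents_mult[OF assms] idempotents_mult[OF assms(2,1)]
    by (simp_all add: idempotents_def mult.assoc)
  have "(e * f)\<^sup>\<star> = f * e"
    by (rule star_unique) (simp_all add: mult.assoc ee ff efef fefe)
  then show ?thesis
    using idempotent_star[OF idempotents_mult[OF assms]] by simp
qed

lemma star_mult:
  fixes s t :: "'s::inverse_semigroup"
  shows "(s * t)\<^sup>\<star> = t\<^sup>\<star> * s\<^sup>\<star>"
proof (rule star_unique)
  have comm: "(t * t\<^sup>\<star>) * (s\<^sup>\<star> * s) = (s\<^sup>\<star> * s) * (t * t\<^sup>\<star>)"
    by (rule idempotents_commute[OF mult_star_idempotent star_mult_idempotent])
  have "s * t * (t\<^sup>\<star> * s\<^sup>\<star>) * (s * t) = s * ((t * t\<^sup>\<star>) * (s\<^sup>\<star> * s)) * t"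
    by (simp only: mult.assoc)
  also have "\<dots> = (s * s\<^sup>\<star> * s) * (t * t\<^sup>\<star> * t)"
    unfolding comm by (simp only: mult.assoc)
  finally show "s * t * (t\<^sup>\<star> * s\<^sup>\<star>) * (s * t) = s * t"
    by (simp add: mult_star_mult)
  have "t\<^sup>\<star> * s\<^sup>\<star> * (s * t) * (t\<^sup>\<star> * s\<^sup>\<star>) = t\<^sup>\<star> * ((s\<^sup>\<star> * s) * (t * t\<^sup>\<star>)) * s\<^sup>\<star>"
    by (simp only: mult.assoc)
  also have "\<dots> = (t\<^sup>\<star> * t * t\<^sup>\<star>) * (s\<^sup>\<star> * s * s\<^sup>\<star>)"
    unfolding comm[symmetric] by (simp only: mult.assoc)
  finally show "t\<^sup>\<star> * s\<^sup>\<star> * (s * t) * (t\<^sup>\<star> * s\<^sup>\<star>) = t\<^sup>\<star> * s\<^sup>\<star>"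
    by (simp add: star_mult_star)
qed

lemma conj_star_mult:
  assumes "e \<in> idempotents"
  shows "(e * s)\<^sup>\<star> * (e * s) = s\<^sup>\<star> * e * s"
proof -
  have "e * (e * s) = e * s"
    using assms by (simp add: idempotents_def flip: mult.assoc)
  then show ?thesis
    by (simp add: star_mult idempotent_star[OF assms] mult.assoc)
qed

lemma conj_idempotent: "e \<in> idempotents \<Longrightarrow> s\<^sup>\<star> * e * s \<in> idempotents"
  using star_mult_idempotent[of "e * s"] by (simp add: conj_star_mult)

lemma conj_mult:
  assumes "e \<in> idempotents"
  shows "s\<^sup>\<star> * (e * f) * s = (s\<^sup>\<star> * e * s) * (s\<^sup>\<star> * f * s)"
proof -
  have "(s\<^sup>\<star> * e * s) * (s\<^sup>\<star> * f * s) = s\<^sup>\<star> * (e * (s * s\<^sup>\<star>)) * f * s"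
    by (simp only: mult.assoc)
  also have "\<dots> = (s\<^sup>\<star> * s * s\<^sup>\<star>) * (e * f) * s"
    unfolding idempotents_commute[OF assms mult_star_idempotent] by (simp only: mult.assoc)
  finally show ?thesis
    by (simp add: star_mult_star)
qed

lemma natural_le_idempotents:
  assumes "e \<in> idempotents"
  shows "e \<preceq> f \<longleftrightarrow> f * e = e"
  using assms by (simp add: natural_le_def idempotent_star idempotents_def mult.assoc)

section \<open>Actions by partial bijections\<close>

locale inverse_semigroup_action =
  fixes X :: "'x topology" and \<theta> :: "'s::inverse_semigroup \<Rightarrow> ('x \<rightharpoonup> 'x)"
  assumes action: "is_action X \<theta>"
begin

lemma act_mult: "\<theta> (s * t) = \<theta> s \<circ>\<^sub>m \<theta> t"
  using action by (simp add: is_action_def)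

lemma act_mult_apply: "\<theta> (s * t) x = Option.bind (\<theta> t x) (\<theta> s)"
  by (auto simp: act_mult map_comp_def split: option.split)

lemma act_in_topspace: "\<theta> s x = Some y \<Longrightarrow> y \<in> topspace X"
  using action unfolding is_action_def partial_bijection_def by (blast intro: ranI)

lemma act_inj: "\<theta> s x = Some z \<Longrightarrow> \<theta> s y = Some z \<Longrightarrow> x = y"
  using action unfolding is_action_def partial_bijection_def inj_on_def
  by (metis domI)

text \<open>
  An injective idempotent partial map is a partial identity; thus \<open>act_dom \<theta> e\<close> is the whole domain
  of \<open>\<theta> e\<close>.
\<close>

lemma act_idempotent:
  assumes "e \<in> idempotents" "\<theta> e x = Some y"
  shows "y = x"
proof -
  have "Some y = \<theta> (e * e) x"
    using assms by (simp add: idempotents_def)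
  also have "\<dots> = \<theta> e y"
    by (simp add: act_mult_apply assms(2))
  finally show ?thesis
    using act_inj[OF assms(2), of y] by simp
qed

lemma dom_act: "dom (\<theta> s) = act_dom \<theta> (s\<^sup>\<star> * s)"
proof (intro set_eqI iffI)
  fix x assume "x \<in> dom (\<theta> s)"
  moreover have "\<theta> s x = Option.bind (\<theta> (s\<^sup>\<star> * s) x) (\<theta> s)"
    using act_mult_apply[of s "s\<^sup>\<star> * s" x] by (simp add: mult_star_mult flip: mult.assoc)
  ultimately show "x \<in> act_dom \<theta> (s\<^sup>\<star> * s)"
    using act_idempotent[OF star_mult_idempotent[of s], of x]
    by (cases "\<theta> (s\<^sup>\<star> * s) x") (auto simp: act_dom_def)
next
  fix x assume "x \<in> act_dom \<theta> (s\<^sup>\<star> * s)"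
  then show "x \<in> dom (\<theta> s)"
    by (cases "\<theta> s x") (auto simp: act_dom_def act_mult_apply)
qed

text \<open>
  Membership in the domain of a conjugate \<open>s\<^sup>\<star> e s\<close> is traded for a condition on the image point:
  both sides describe the domain of \<open>\<theta> (e * s) = \<theta> e \<circ>\<^sub>m \<theta> s\<close>.
\<close>

lemma act_dom_conj:
  assumes "e \<in> idempotents"
  shows "x \<in> act_dom \<theta> (s\<^sup>\<star> * e * s) \<longleftrightarrow> (\<exists>y. \<theta> s x = Some y \<and> y \<in> act_dom \<theta> e)"
proof -
  have "x \<in> act_dom \<theta> (s\<^sup>\<star> * e * s) \<longleftrightarrow> x \<in> dom (\<theta> (e * s))"
    by (simp add: dom_act conj_star_mult[OF assms])
  also have "\<dots> \<longleftrightarrow> (\<exists>y. \<theta> s x = Some y \<and> y \<in> dom (\<theta> e))"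
    by (cases "\<theta> s x") (auto simp: act_mult_apply)
  also have "dom (\<theta> e) = act_dom \<theta> e"
    using assms by (simp add: dom_act idempotent_star_mult)
  finally show ?thesis .
qed

lemma openin_act_dom: "e \<in> idempotents \<Longrightarrow> openin X (act_dom \<theta> e)"
  using action by (simp add: is_action_def)

lemma act_dom_subset_topspace: "e \<in> idempotents \<Longrightarrow> act_dom \<theta> e \<subseteq> topspace X"
  by (simp add: openin_act_dom openin_subset)

lemma openin_act_preimage:
  assumes "openin X U"
  shows "openin X {x \<in> dom (\<theta> s). the (\<theta> s x) \<in> U}"
proof -
  let ?D = "act_dom \<theta> (s\<^sup>\<star> * s)" and ?R = "act_dom \<theta> (s * s\<^sup>\<star>)"
  have "continuous_map (subtopology X ?D) (subtopology X ?R) (\<lambda>x. the (\<theta> s x))"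
    using action by (simp add: is_action_def)
  then have "continuous_map (subtopology X ?D) X (\<lambda>x. the (\<theta> s x))"
    by (simp add: continuous_map_in_subtopology)
  then have "openin (subtopology X ?D) {x \<in> topspace (subtopology X ?D). the (\<theta> s x) \<in> U}"
    using assms by (rule openin_continuous_map_preimage)
  moreover have "topspace (subtopology X ?D) = dom (\<theta> s)"
    using act_dom_subset_topspace[OF star_mult_idempotent[of s]] by (auto simp: dom_act)
  ultimately show ?thesis
    using openin_act_dom[OF star_mult_idempotent] by (metis openin_trans_full)
qed

section \<open>Points of the KS space as filters over points\<close>

definition filter_at :: "'x \<Rightarrow> 's set \<Rightarrow> bool"
  where "filter_at x F \<longleftrightarrow> F \<subseteq> idempotents \<and> F \<noteq> {} \<and>
    (\<forall>e\<in>idempotents. \<forall>f\<in>idempotents. e * f \<in> F \<longleftrightarrow> e \<in> F \<and> f \<in> F) \<and>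
    (\<forall>e\<in>F. x \<in> act_dom \<theta> e)"

definition KS_point :: "'x \<Rightarrow> 's set \<Rightarrow> ('s \<Rightarrow> 'x option)"
  where "KS_point x F = (\<lambda>e\<in>idempotents. if e \<in> F then Some x else None)"

lemma KS_point_apply: "e \<in> idempotents \<Longrightarrow> KS_point x F e = (if e \<in> F then Some x else None)"
  by (simp add: KS_point_def)

lemma filter_at_mult:
  "filter_at x F \<Longrightarrow> e \<in> idempotents \<Longrightarrow> f \<in> idempotents \<Longrightarrow> e * f \<in> F \<longleftrightarrow> e \<in> F \<and> f \<in> F"
  by (simp add: filter_at_def)

lemma filter_at_dom: "filter_at x F \<Longrightarrow> e \<in> F \<Longrightarrow> x \<in> act_dom \<theta> e"
  by (simp add: filter_at_def)

lemma topspace_KS_product: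
  "topspace (KS_product X \<theta>) = (\<Pi>\<^sub>E e\<in>idempotents. insert None (Some ` act_dom \<theta> e))"
  unfolding KS_product_def topspace_product_topology
  by (rule PiE_cong) (use act_dom_subset_topspace in auto)

text \<open>
  Condition (1) says that finiteness at \<open>e f\<close> forces the same finite value at \<open>e\<close> and at \<open>f\<close>, and
  condition (2) is the converse for finiteness. Together they make the set of finite coordinates a
  filter on which \<open>\<tau>\<close> is constant. Excluding \<open>\<infinity>\<close> makes the filter nonempty, so that it determines
  its base point.
\<close>

lemma topspace_KS_space: "topspace (KS_space X \<theta>) = {KS_point x F |x F. filter_at x F}"
proof (intro set_eqI iffI)
  fix \<tau> assume "\<tau> \<in> topspace (KS_space X \<theta>)"
  then have tilde: "\<tau> \<in> KS_tilde_set X \<theta>" and "\<tau> \<noteq> KS_infty"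
    by (simp_all add: KS_space_def)
  have prod: "\<tau> \<in> (\<Pi>\<^sub>E e\<in>idempotents. insert None (Some ` act_dom \<theta> e))"
    using tilde by (simp add: KS_tilde_set_def topspace_KS_product)
  have mono: "\<tau> f = Some x"
    if "e \<in> idempotents" "f \<in> idempotents" "f * e = e" "\<tau> e = Some x" for e f x
  proof -
    have "e \<preceq> f"
      using that by (simp add: natural_le_idempotents)
    then have "\<tau> f = \<tau> e"
      using tilde that unfolding KS_tilde_set_def by blast
    with that show ?thesis by simp
  qed
  have mult: "\<tau> (e * f) \<noteq> None"
    if "e \<in> idempotents" "f \<in> idempotents" "\<tau> e \<noteq> None" "\<tau> f \<noteq> None" for e f
    using tilde that unfolding KS_tilde_set_def by blast
  have below: "\<tau> e = Some x \<and> \<tau> f = Some x"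
    if "e \<in> idempotents" "f \<in> idempotents" "\<tau> (e * f) = Some x" for e f x
  proof -
    have ee: "e * e = e" and ff: "f * f = f"
      using that by (simp_all add: idempotents_def)
    have "e * (e * f) = e * f"
      by (simp add: ee flip: mult.assoc)
    moreover have "f * (e * f) = e * f"
      unfolding idempotents_commute[OF that(1,2)] by (simp add: ff flip: mult.assoc)
    ultimately show ?thesis
      using mono[OF idempotents_mult[OF that(1,2)] that(1) _ that(3)]
        mono[OF idempotents_mult[OF that(1,2)] that(2) _ that(3)] by blast
  qed
  define F where "F = {e \<in> idempotents. \<tau> e \<noteq> None}"
  obtain e0 x where e0: "e0 \<in> idempotents" "\<tau> e0 = Some x"
  proof -
    have "\<exists>e\<in>idempotents. \<tau> e \<noteq> None"
    proof (rule ccontr)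
      assume "\<not> ?thesis"
      then have "\<tau> = KS_infty"
        using prod by (intro extensionalityI[where A = idempotents])
          (auto simp: PiE_def KS_infty_def)
      with \<open>\<tau> \<noteq> KS_infty\<close> show False ..
    qed
    then show thesis using that by blast
  qed
  \<comment> \<open>All finite coordinates coincide, because any two of them equal the one at the product.\<close>
  have const: "\<tau> e = Some x" if e: "e \<in> F" for e
  proof -
    obtain z where "\<tau> (e * e0) = Some z"
      using mult[OF _ e0(1), of e] e e0 by (auto simp: F_def)
    then show ?thesis
      using below[of e e0 z] e e0 by (auto simp: F_def)
  qed
  have "filter_at x F"
    unfolding filter_at_def
  proof (intro conjI ballI)
    show "F \<subseteq> idempotents" "F \<noteq> {}"
      using e0 by (auto simp: F_def)
  next
    fix e f :: 's assume ef: "e \<in> idempotents" "f \<in> idempotents"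
    then show "e * f \<in> F \<longleftrightarrow> e \<in> F \<and> f \<in> F"
      using mult[OF ef] below[OF ef] idempotents_mult[OF ef] by (auto simp: F_def)
  next
    fix e assume "e \<in> F"
    then show "x \<in> act_dom \<theta> e"
      using const[of e] prod by (auto simp: F_def PiE_def Pi_def)
  qed
  moreover have "\<tau> = KS_point x F"
  proof (rule extensionalityI[where A = idempotents])
    show "\<tau> \<in> extensional idempotents"
      using prod by (simp add: PiE_def)
    show "\<tau> e = KS_point x F e" if "e \<in> idempotents" for e
      using that const[of e] by (auto simp: KS_point_apply F_def)
  qed (simp add: KS_point_def)
  ultimately show "\<tau> \<in> {KS_point x F |x F. filter_at x F}"
    by blast
next
  fix \<tau> assume "\<tau> \<in> {KS_point x F |x F. filter_at x F}"
  then obtain x F where \<tau>: "\<tau> = KS_point x F" and F: "filter_at x F"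
    by blast
  obtain e where e: "e \<in> F" "e \<in> idempotents"
    using F by (auto simp: filter_at_def)
  have "\<tau> \<in> (\<Pi>\<^sub>E e\<in>idempotents. insert None (Some ` act_dom \<theta> e))"
    using filter_at_dom[OF F] by (auto simp: \<tau> KS_point_def)
  moreover have "\<tau> \<noteq> KS_infty"
  proof
    assume "\<tau> = KS_infty"
    then have "\<tau> e = KS_infty e" by simp
    then show False using e by (simp add: \<tau> KS_point_apply KS_infty_def)
  qed
  moreover have "\<tau> f = \<tau> e" if "e \<in> idempotents" "f \<in> idempotents" "e \<preceq> f" "\<tau> e \<noteq> None" for e f
    using that filter_at_mult[OF F, of f e]
    by (auto simp: \<tau> KS_point_apply natural_le_idempotents split: if_splits)
  moreover have "\<tau> (e * f) \<noteq> None"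
    if "e \<in> idempotents" "f \<in> idempotents" "\<tau> e \<noteq> None" "\<tau> f \<noteq> None" for e f
    using that filter_at_mult[OF F, of e f]
    by (auto simp: \<tau> KS_point_apply idempotents_mult split: if_splits)
  ultimately show "\<tau> \<in> topspace (KS_space X \<theta>)"
    unfolding KS_space_def KS_tilde_set_def by (auto simp: topspace_KS_product)
qed

lemma KS_point_in_KS_dom:
  assumes "filter_at x F" "e \<in> idempotents"
  shows "KS_point x F \<in> KS_dom X \<theta> e \<longleftrightarrow> e \<in> F"
  using assms by (auto simp: KS_dom_def topspace_KS_space KS_point_apply)

lemma KS_dom_cases:
  assumes "\<tau> \<in> KS_dom X \<theta> e" "e \<in> idempotents"
  obtains x F where "\<tau> = KS_point x F" "filter_at x F" "e \<in> F"
proof -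
  obtain x F where "\<tau> = KS_point x F" "filter_at x F"
    using assms by (auto simp: KS_dom_def topspace_KS_space)
  with that show thesis
    using assms KS_point_in_KS_dom by blast
qed

lemma topspace_KS_space_eq_Union: "topspace (KS_space X \<theta>) = (\<Union>e\<in>idempotents. KS_dom X \<theta> e)"
proof
  show "topspace (KS_space X \<theta>) \<subseteq> (\<Union>e\<in>idempotents. KS_dom X \<theta> e)"
  proof
    fix \<tau> assume "\<tau> \<in> topspace (KS_space X \<theta>)"
    then obtain x F where \<tau>: "\<tau> = KS_point x F" and F: "filter_at x F"
      by (auto simp: topspace_KS_space)
    then obtain e where "e \<in> F" "e \<in> idempotents"
      by (auto simp: filter_at_def)
    with \<tau> F show "\<tau> \<in> (\<Union>e\<in>idempotents. KS_dom X \<theta> e)"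
      using KS_point_in_KS_dom by blast
  qed
qed (auto simp: KS_dom_def)

section \<open>The induced partial maps\<close>

text \<open>
  Conjugation \<open>e \<mapsto> s\<^sup>\<star> e s\<close> is multiplicative on idempotents, so it pulls filters back to filters; the
  pullback contains \<open>s s\<^sup>\<star>\<close> precisely because \<open>s\<^sup>\<star> s\<close> lies in \<open>F\<close>.
\<close>

lemma filter_at_conj:
  assumes F: "filter_at x F" and s: "s\<^sup>\<star> * s \<in> F"
  shows "filter_at (the (\<theta> s x)) {e \<in> idempotents. s\<^sup>\<star> * e * s \<in> F}"
    (is "filter_at ?y ?G")
  unfolding filter_at_def
proof (intro conjI ballI)
  have "s\<^sup>\<star> * (s * s\<^sup>\<star>) * s = s\<^sup>\<star> * s"
    by (metis mult.assoc star_mult_star)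
  then show "?G \<noteq> {}"
    using s mult_star_idempotent[of s] by auto
next
  fix e f :: 's assume "e \<in> idempotents" "f \<in> idempotents"
  then show "e * f \<in> ?G \<longleftrightarrow> e \<in> ?G \<and> f \<in> ?G"
    by (simp add: idempotents_mult conj_mult filter_at_mult[OF F] conj_idempotent)
next
  fix e assume "e \<in> ?G"
  then show "?y \<in> act_dom \<theta> e"
    using filter_at_dom[OF F, of "s\<^sup>\<star> * e * s"] by (auto simp: act_dom_conj)
qed auto

text \<open>
  The factor \<open>e\<close> in \<open>\<theta> (e * s)\<close> only restricts the domain, so every finite coordinate of the image
  is the same point \<open>\<theta>\<^sub>s x\<close>.
\<close>

lemma KS_map_point:
  assumes F: "filter_at x F"
  shows "KS_map \<theta> s (KS_point x F) =
    KS_point (the (\<theta> s x)) {e \<in> idempotents. s\<^sup>\<star> * e * s \<in> F}"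
proof (rule extensionalityI[where A = idempotents])
  fix e :: 's assume e: "e \<in> idempotents"
  have "the (\<theta> (e * s) x) = the (\<theta> s x)" if eF: "s\<^sup>\<star> * e * s \<in> F"
  proof -
    obtain y where "\<theta> s x = Some y" "y \<in> act_dom \<theta> e"
      using filter_at_dom[OF F eF] e by (auto simp: act_dom_conj)
    then show ?thesis
      by (simp add: act_mult_apply act_dom_def)
  qed
  with e show "KS_map \<theta> s (KS_point x F) e =
      KS_point (the (\<theta> s x)) {e \<in> idempotents. s\<^sup>\<star> * e * s \<in> F} e"
    by (simp add: KS_map_def KS_point_apply conj_idempotent)
qed (auto simp: KS_map_def KS_point_def)

lemma KS_act_point:
  assumes "filter_at x F"
  shows "KS_act X \<theta> s (KS_point x F) = (if s\<^sup>\<star> * s \<in> F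
    then Some (KS_point (the (\<theta> s x)) {e \<in> idempotents. s\<^sup>\<star> * e * s \<in> F}) else None)"
  by (simp add: KS_act_def KS_map_point[OF assms] KS_point_in_KS_dom[OF assms star_mult_idempotent])

lemma KS_act_outside: "\<tau> \<notin> topspace (KS_space X \<theta>) \<Longrightarrow> KS_act X \<theta> s \<tau> = None"
  by (simp add: KS_act_def KS_dom_def)

lemma dom_KS_act: "dom (KS_act X \<theta> s) = KS_dom X \<theta> (s\<^sup>\<star> * s)"
  by (auto simp: KS_act_def dom_def)

lemma KS_act_mult: "KS_act X \<theta> (s * t) = KS_act X \<theta> s \<circ>\<^sub>m KS_act X \<theta> t"
proof
  fix \<tau>
  show "KS_act X \<theta> (s * t) \<tau> = (KS_act X \<theta> s \<circ>\<^sub>m KS_act X \<theta> t) \<tau>"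
  proof (cases "\<tau> \<in> topspace (KS_space X \<theta>)")
    case False
    then show ?thesis by (simp add: KS_act_outside)
  next
    case True
    then obtain x F where \<tau>: "\<tau> = KS_point x F" and F: "filter_at x F"
      by (auto simp: topspace_KS_space)
    have conj: "(s * t)\<^sup>\<star> * e * (s * t) = t\<^sup>\<star> * (s\<^sup>\<star> * e * s) * t" for e
      by (simp add: star_mult mult.assoc)
    have st: "(s * t)\<^sup>\<star> * (s * t) = t\<^sup>\<star> * (s\<^sup>\<star> * s) * t"
      by (simp add: star_mult mult.assoc)
    show ?thesis
    proof (cases "t\<^sup>\<star> * t \<in> F")
      case True
      define y where "y = the (\<theta> t x)"
      define G where "G = {e \<in> idempotents. t\<^sup>\<star> * e * t \<in> F}"
      have G: "filter_at y G" and t\<tau>: "KS_act X \<theta> t \<tau> = Some (KS_point y G)"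
        using filter_at_conj[OF F True] True by (simp_all add: y_def G_def \<tau> KS_act_point[OF F])
      have y: "\<theta> t x = Some y"
        using filter_at_dom[OF F True] unfolding dom_act[symmetric] by (auto simp: y_def)
      have "s\<^sup>\<star> * s \<in> G \<longleftrightarrow> (s * t)\<^sup>\<star> * (s * t) \<in> F"
        by (simp add: G_def st star_mult_idempotent)
      moreover have "{e \<in> idempotents. s\<^sup>\<star> * e * s \<in> G} =
          {e \<in> idempotents. (s * t)\<^sup>\<star> * e * (s * t) \<in> F}"
        by (auto simp: G_def conj conj_idempotent)
      moreover have "\<theta> (s * t) x = \<theta> s y"
        by (simp add: act_mult_apply y)
      ultimately show ?thesis
        by (simp add: t\<tau> map_comp_def KS_act_point[OF G]) (simp add: \<tau> KS_act_point[OF F])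
    next
      case False
      \<comment> \<open>The domain idempotent of \<open>s t\<close> lies below that of \<open>t\<close>, so neither side is defined at \<open>\<tau>\<close>.\<close>
      have "(s * t)\<^sup>\<star> * (s * t) = (s * t)\<^sup>\<star> * (s * t) * (t\<^sup>\<star> * t)"
        by (metis mult.assoc mult_star_mult)
      then have "(s * t)\<^sup>\<star> * (s * t) \<notin> F"
        using filter_at_mult[OF F star_mult_idempotent[of "s * t"] star_mult_idempotent[of t]] False
        by simp
      with False show ?thesis
        by (simp add: \<tau> KS_act_point[OF F])
    qed
  qed
qed

lemma KS_act_idempotent:
  assumes "e \<in> idempotents" "\<tau> \<in> KS_dom X \<theta> e"
  shows "KS_act X \<theta> e \<tau> = Some \<tau>"
proof -
  obtain x F where \<tau>: "\<tau> = KS_point x F" and F: "filter_at x F" and "e \<in> F"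
    using assms KS_dom_cases by blast
  have "{f \<in> idempotents. e * f * e \<in> F} = F"
    using \<open>e \<in> F\<close> assms(1) F
    by (auto simp: filter_at_mult[OF F] idempotents_mult filter_at_def)
  moreover have "\<theta> e x = Some x"
    using filter_at_dom[OF F \<open>e \<in> F\<close>] by (simp add: act_dom_def)
  ultimately show ?thesis
    using \<open>e \<in> F\<close> assms(1) F
    by (simp add: \<tau> KS_act_point[OF F] idempotent_star_mult filter_at_mult[OF F] idempotent_star)
qed

lemma act_dom_KS_act:
  assumes "e \<in> idempotents"
  shows "act_dom (KS_act X \<theta>) e = KS_dom X \<theta> e"
proof -
  have "dom (KS_act X \<theta> e) = KS_dom X \<theta> e"
    using assms by (simp add: dom_KS_act idempotent_star_mult)
  then show ?thesis
    using KS_act_idempotent[OF assms] by (auto simp: act_dom_def)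
qed

text \<open>
  The product \<open>s\<^sup>\<star> s\<close> acts as the identity on its domain and as the composite of the two maps.
\<close>

lemma KS_map_star_KS_map:
  assumes "\<tau> \<in> KS_dom X \<theta> (s\<^sup>\<star> * s)"
  shows "KS_map \<theta> s \<tau> \<in> KS_dom X \<theta> (s * s\<^sup>\<star>)"
    and "KS_map \<theta> (s\<^sup>\<star>) (KS_map \<theta> s \<tau>) = \<tau>"
proof -
  have "Some \<tau> = (KS_act X \<theta> (s\<^sup>\<star>) \<circ>\<^sub>m KS_act X \<theta> s) \<tau>"
    using KS_act_idempotent[OF star_mult_idempotent assms] by (simp add: KS_act_mult)
  also have "\<dots> = KS_act X \<theta> (s\<^sup>\<star>) (KS_map \<theta> s \<tau>)"
    using assms by (simp add: KS_act_def)
  finally show "KS_map \<theta> s \<tau> \<in> KS_dom X \<theta> (s * s\<^sup>\<star>)" "KS_map \<theta> (s\<^sup>\<star>) (KS_map \<theta> s \<tau>) = \<tau>"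
    by (auto simp: KS_act_def split: if_splits)
qed

section \<open>Continuity\<close>

lemma continuous_map_KS_eval:
  assumes "e \<in> idempotents"
  shows "continuous_map (KS_space X \<theta>)
    (Alexandroff_compactification (subtopology X (act_dom \<theta> e))) (\<lambda>\<tau>. \<tau> e)"
  unfolding KS_space_def KS_product_def
  by (intro continuous_map_from_subtopology continuous_map_product_projection assms)

lemma openin_KS_eval_in:
  assumes "e \<in> idempotents" "openin X U" "U \<subseteq> act_dom \<theta> e"
  shows "openin (KS_space X \<theta>) {\<tau> \<in> topspace (KS_space X \<theta>). \<tau> e \<in> Some ` U}"
proof (rule openin_continuous_map_preimage[OF continuous_map_KS_eval[OF assms(1)]])
  have "openin (subtopology X (act_dom \<theta> e)) U"
    using assms by (simp add: openin_open_subtopology openin_act_dom)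
  then show "openin (Alexandroff_compactification (subtopology X (act_dom \<theta> e))) (Some ` U)"
    by simp
qed

lemma openin_KS_dom:
  assumes "e \<in> idempotents"
  shows "openin (KS_space X \<theta>) (KS_dom X \<theta> e)"
proof -
  have "KS_dom X \<theta> e = {\<tau> \<in> topspace (KS_space X \<theta>). \<tau> e \<in> Some ` act_dom \<theta> e}"
    using assms
    by (auto simp: KS_dom_def topspace_KS_space KS_point_apply filter_at_dom split: if_splits)
  then show ?thesis
    using openin_KS_eval_in[OF assms openin_act_dom[OF assms]] by simp
qed

lemma openin_KS_eval_notin_compact:
  assumes "Hausdorff_space X" "e \<in> idempotents" "compactin X C" "C \<subseteq> act_dom \<theta> e"
  shows "openin (KS_space X \<theta>) {\<tau> \<in> topspace (KS_space X \<theta>). \<tau> e \<notin> Some ` C}"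
proof -
  let ?A = "Alexandroff_compactification (subtopology X (act_dom \<theta> e))"
  have "closedin (subtopology X (act_dom \<theta> e)) C"
    using assms by (simp add: closedin_subset_topspace compactin_imp_closedin)
  then have "closedin ?A (Some ` C)"
    using assms by (simp add: compactin_subtopology)
  then have "openin ?A (topspace ?A - Some ` C)"
    by blast
  then have "openin (KS_space X \<theta>)
      {\<tau> \<in> topspace (KS_space X \<theta>). \<tau> e \<in> topspace ?A - Some ` C}"
    by (rule openin_continuous_map_preimage[OF continuous_map_KS_eval[OF assms(2)]])
  also have "{\<tau> \<in> topspace (KS_space X \<theta>). \<tau> e \<in> topspace ?A - Some ` C} =
      {\<tau> \<in> topspace (KS_space X \<theta>). \<tau> e \<notin> Some ` C}"
    using continuous_map_KS_eval[OF assms(2)]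
    by (auto simp: continuous_map_def Pi_def simp del: topspace_Alexandroff_compactification)
  finally show ?thesis .
qed

text \<open>
  The topology of the factor at \<open>f\<close> alone would give this for compact \<open>L\<close>; for a set that is closed
  relative to the domain of \<open>p\<close>, the \<open>p\<close>-coordinate \<open>x\<close>, finite on \<open>KS_dom X \<theta> p\<close>, has to help.
  If \<open>x \<notin> L\<close>, nearby points have their \<open>p\<close>-coordinate outside \<open>L\<close>, hence
  also their \<open>f\<close>-coordinate if it is finite. If \<open>x \<in> L\<close>, the \<open>f\<close>-coordinate is \<open>\<infinity>\<close>; for a compact
  neighbourhood \<open>C\<close> of \<open>x\<close> in the domain of \<open>f\<close>, nearby points have their \<open>p\<close>-coordinate inside \<open>C\<close>
  and their \<open>f\<close>-coordinate outside \<open>C\<close>, so that the latter cannot be finite.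
\<close>

lemma openin_KS_eval_notin_relatively_closed:
  assumes X: "locally_compact_space X" "Hausdorff_space X"
    and p: "p \<in> idempotents" and f: "f \<in> idempotents"
    and L: "L \<subseteq> act_dom \<theta> f" "openin X (act_dom \<theta> p - L)"
  shows "openin (KS_space X \<theta>) {\<tau> \<in> KS_dom X \<theta> p. \<tau> f \<notin> Some ` L}"
proof (subst openin_subopen, intro ballI)
  fix \<tau> assume "\<tau> \<in> {\<tau> \<in> KS_dom X \<theta> p. \<tau> f \<notin> Some ` L}"
  then have "\<tau> \<in> KS_dom X \<theta> p" and \<tau>f: "\<tau> f \<notin> Some ` L"
    by auto
  then obtain x F where \<tau>: "\<tau> = KS_point x F" and F: "filter_at x F" and pF: "p \<in> F"
    using p KS_dom_cases by blast
  have \<tau>top: "\<tau> \<in> topspace (KS_space X \<theta>)" and \<tau>p: "\<tau> p = Some x"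
    using F pF p by (auto simp: \<tau> topspace_KS_space KS_point_apply)
  have agree: "y = z" if "\<sigma> \<in> topspace (KS_space X \<theta>)" "\<sigma> p = Some y" "\<sigma> f = Some z" for \<sigma> y z
    using that p f by (auto simp: topspace_KS_space KS_point_apply split: if_splits)
  show "\<exists>T. openin (KS_space X \<theta>) T \<and> \<tau> \<in> T \<and> T \<subseteq> {\<tau> \<in> KS_dom X \<theta> p. \<tau> f \<notin> Some ` L}"
  proof (cases "x \<in> L")
    case False
    let ?T = "{\<sigma> \<in> topspace (KS_space X \<theta>). \<sigma> p \<in> Some ` (act_dom \<theta> p - L)}"
    have "openin (KS_space X \<theta>) ?T"
      using openin_KS_eval_in[OF p L(2)] by blast
    moreover have "\<tau> \<in> ?T"
      using \<tau>top \<tau>p False filter_at_dom[OF F pF] by auto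
    moreover have "?T \<subseteq> {\<tau> \<in> KS_dom X \<theta> p. \<tau> f \<notin> Some ` L}"
      by (auto simp: KS_dom_def dest: agree)
    ultimately show ?thesis by blast
  next
    case True
    then have "\<tau> f = None"
      using \<tau>f f by (auto simp: \<tau> KS_point_apply)
    have "locally_compact_space (subtopology X (act_dom \<theta> f))"
      using X openin_act_dom[OF f] by (blast intro: locally_compact_space_open_subset)
    moreover have "x \<in> topspace (subtopology X (act_dom \<theta> f))"
      using True L act_dom_subset_topspace[OF f] by auto
    ultimately obtain U C where UC: "openin (subtopology X (act_dom \<theta> f)) U"
      "compactin (subtopology X (act_dom \<theta> f)) C" "x \<in> U" "U \<subseteq> C"
      unfolding locally_compact_space_def by meson
    then have U: "openin X U" and C: "compactin X C" "C \<subseteq> act_dom \<theta> f"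
      using openin_act_dom[OF f] by (auto simp: compactin_subtopology openin_open_subtopology)
    let ?T = "{\<sigma> \<in> topspace (KS_space X \<theta>). \<sigma> p \<in> Some ` (U \<inter> act_dom \<theta> p)} \<inter>
      {\<sigma> \<in> topspace (KS_space X \<theta>). \<sigma> f \<notin> Some ` C}"
    have "openin (KS_space X \<theta>) ?T"
      by (intro openin_Int openin_KS_eval_in openin_KS_eval_notin_compact)
        (use p f U C X openin_act_dom in auto)
    moreover have "\<tau> \<in> ?T"
      using \<tau>top \<tau>p \<open>\<tau> f = None\<close> UC filter_at_dom[OF F pF] by auto
    moreover have "?T \<subseteq> {\<tau> \<in> KS_dom X \<theta> p. \<tau> f \<notin> Some ` L}"
      using UC(4) by (auto simp: KS_dom_def dest: agree)
    ultimately show ?thesis by blast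
  qed
qed

text \<open>
  Checked in each coordinate \<open>e\<close> of the target, on the two kinds of open sets of a one-point
  compactification. An open subset of \<open>X\<^sub>e\<close> pulls back under \<open>\<theta>\<^sub>s\<close> to an open set. For the complement
  of a compact \<open>C\<close>, the preimage of \<open>C\<close> under \<open>\<theta>\<^sub>s\<close> is relatively closed in the domain of \<open>\<theta>\<^sub>s\<close>, which
  is what the preceding lemma requires.
\<close>

lemma continuous_map_KS_map:
  assumes X: "locally_compact_space X" "Hausdorff_space X"
  shows "continuous_map (subtopology (KS_space X \<theta>) (KS_dom X \<theta> (s\<^sup>\<star> * s)))
    (subtopology (KS_space X \<theta>) (KS_dom X \<theta> (s * s\<^sup>\<star>))) (KS_map \<theta> s)"
proof -
  let ?p = "s\<^sup>\<star> * s" and ?K = "KS_space X \<theta>"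
  let ?D = "KS_dom X \<theta> ?p"
  have p: "?p \<in> idempotents"
    by (rule star_mult_idempotent)
  have "?D \<subseteq> topspace ?K"
    by (auto simp: KS_dom_def)
  then have topD: "topspace (subtopology ?K ?D) = ?D"
    by auto
  have "continuous_map (subtopology ?K ?D) (KS_product X \<theta>) (KS_map \<theta> s)"
    unfolding KS_product_def continuous_map_componentwise
  proof (intro conjI ballI)
    show "KS_map \<theta> s ` topspace (subtopology ?K ?D) \<subseteq> extensional idempotents"
      by (auto simp: KS_map_def)
  next
    fix e :: 's assume e: "e \<in> idempotents"
    let ?A = "Alexandroff_compactification (subtopology X (act_dom \<theta> e))"
    let ?f = "s\<^sup>\<star> * e * s"
    have f: "?f \<in> idempotents"
      by (rule conj_idempotent[OF e])
    have eval: "KS_map \<theta> s \<tau> e \<in> Some ` W \<longleftrightarrow>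
        \<tau> ?f \<in> Some ` {x \<in> dom (\<theta> s). the (\<theta> s x) \<in> W}" if \<tau>D: "\<tau> \<in> ?D" for \<tau> W
    proof -
      obtain x F where \<tau>: "\<tau> = KS_point x F" and F: "filter_at x F" and "?p \<in> F"
        using KS_dom_cases[OF \<tau>D p] by metis
      moreover have "x \<in> dom (\<theta> s)"
        using filter_at_dom[OF F \<open>?p \<in> F\<close>] by (simp add: dom_act)
      ultimately show ?thesis
        using e f by (auto simp: KS_map_point KS_point_apply)
    qed
    have maps: "KS_map \<theta> s \<tau> e \<in> topspace ?A" if "\<tau> \<in> ?D" for \<tau>
    proof -
      have "KS_map \<theta> s \<tau> \<in> topspace ?K"
        using KS_map_star_KS_map(1)[OF that] by (simp add: KS_dom_def)
      then show ?thesis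
        using continuous_map_KS_eval[OF e] unfolding continuous_map_def by blast
    qed
    have "openin ?K {\<tau> \<in> ?D. KS_map \<theta> s \<tau> e \<in> V}" if "openin ?A V" for V
      using that unfolding openin_Alexandroff_compactification
    proof (elim disjE exE conjE)
      fix U assume "openin (subtopology X (act_dom \<theta> e)) U" and V: "V = Some ` U"
      then have U: "openin X U" "U \<subseteq> act_dom \<theta> e"
        using openin_act_dom[OF e] by (auto simp: openin_open_subtopology)
      let ?U = "{x \<in> dom (\<theta> s). the (\<theta> s x) \<in> U}"
      have "?U \<subseteq> act_dom \<theta> ?f"
        using U(2) act_dom_conj[OF e, of _ s] by auto
      then have "openin ?K (?D \<inter> {\<tau> \<in> topspace ?K. \<tau> ?f \<in> Some ` ?U})"
        by (intro openin_Int openin_KS_dom openin_KS_eval_in openin_act_preimage p f U(1))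
      also have "?D \<inter> {\<tau> \<in> topspace ?K. \<tau> ?f \<in> Some ` ?U} = {\<tau> \<in> ?D. KS_map \<theta> s \<tau> e \<in> V}"
        using eval[of _ U] \<open>?D \<subseteq> topspace ?K\<close> unfolding V by blast
      finally show ?thesis .
    next
      fix C assume C': "compactin (subtopology X (act_dom \<theta> e)) C"
        and V': "V = insert None (Some ` (topspace (subtopology X (act_dom \<theta> e)) - C))"
      from V' have V: "V = topspace ?A - Some ` C"
        by auto
      from C' have C: "closedin X C" "C \<subseteq> act_dom \<theta> e"
        using X(2) by (auto simp: compactin_subtopology compactin_imp_closedin)
      let ?L = "{x \<in> dom (\<theta> s). the (\<theta> s x) \<in> C}"
      have "?L \<subseteq> act_dom \<theta> ?f"
        using C(2) act_dom_conj[OF e, of _ s] by auto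
      moreover have "act_dom \<theta> ?p - ?L = {x \<in> dom (\<theta> s). the (\<theta> s x) \<in> topspace X - C}"
        using act_in_topspace[of s] by (auto simp flip: dom_act)
      then have "openin X (act_dom \<theta> ?p - ?L)"
        using openin_act_preimage[of "topspace X - C" s] C(1) by (simp add: openin_diff)
      ultimately have "openin ?K {\<tau> \<in> ?D. \<tau> ?f \<notin> Some ` ?L}"
        by (rule openin_KS_eval_notin_relatively_closed[OF X p f])
      moreover have "{\<tau> \<in> ?D. \<tau> ?f \<notin> Some ` ?L} = {\<tau> \<in> ?D. KS_map \<theta> s \<tau> e \<in> V}"
        using eval[of _ C] maps by (auto simp: V simp del: topspace_Alexandroff_compactification)
      ultimately show ?thesis by (simp only:)
    qed
    then show "continuous_map (subtopology ?K ?D) ?A (\<lambda>\<tau>. KS_map \<theta> s \<tau> e)"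
      using maps unfolding continuous_map_def topD
      by (auto simp: openin_open_subtopology openin_KS_dom[OF p]
          simp del: topspace_Alexandroff_compactification)
  qed
  moreover have "KS_map \<theta> s \<tau> \<in> KS_tilde_set X \<theta> - {KS_infty}"
    and "KS_map \<theta> s \<tau> \<in> KS_dom X \<theta> (s * s\<^sup>\<star>)" if "\<tau> \<in> ?D" for \<tau>
    using KS_map_star_KS_map(1)[OF that] by (auto simp: KS_dom_def KS_space_def)
  ultimately show ?thesis
    unfolding continuous_map_in_subtopology topD
    by (subst (2) KS_space_def) (auto simp: continuous_map_in_subtopology topD)
qed

lemma homeomorphic_map_KS_map:
  assumes X: "locally_compact_space X" "Hausdorff_space X"
  shows "homeomorphic_map (subtopology (KS_space X \<theta>) (KS_dom X \<theta> (s\<^sup>\<star> * s)))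
    (subtopology (KS_space X \<theta>) (KS_dom X \<theta> (s * s\<^sup>\<star>))) (KS_map \<theta> s)"
proof (rule homeomorphic_maps_imp_map[where g = "KS_map \<theta> (s\<^sup>\<star>)"])
  show "homeomorphic_maps (subtopology (KS_space X \<theta>) (KS_dom X \<theta> (s\<^sup>\<star> * s)))
    (subtopology (KS_space X \<theta>) (KS_dom X \<theta> (s * s\<^sup>\<star>))) (KS_map \<theta> s) (KS_map \<theta> (s\<^sup>\<star>))"
    unfolding homeomorphic_maps_def
    using continuous_map_KS_map[OF X, of s] continuous_map_KS_map[OF X, of "s\<^sup>\<star>"]
      KS_map_star_KS_map(2)[of _ s] KS_map_star_KS_map(2)[of _ "s\<^sup>\<star>"]
    by simp
qed

lemma is_action_KS_act:
  assumes X: "locally_compact_space X" "Hausdorff_space X"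
  shows "is_action (KS_space X \<theta>) (KS_act X \<theta>)"
  unfolding is_action_def
proof (intro conjI allI ballI)
  fix s
  show "partial_bijection (topspace (KS_space X \<theta>)) (KS_act X \<theta> s)"
    unfolding partial_bijection_def
  proof (intro conjI)
    show "dom (KS_act X \<theta> s) \<subseteq> topspace (KS_space X \<theta>)"
      by (auto simp: dom_KS_act KS_dom_def)
    show "ran (KS_act X \<theta> s) \<subseteq> topspace (KS_space X \<theta>)"
      using KS_map_star_KS_map(1)[of _ s] by (auto simp: ran_def KS_act_def KS_dom_def split: if_splits)
    show "inj_on (KS_act X \<theta> s) (dom (KS_act X \<theta> s))"
      unfolding dom_KS_act
      by (rule inj_onI) (metis KS_act_def KS_map_star_KS_map(2) option.inject)
  qed
  show "continuous_map (subtopology (KS_space X \<theta>) (act_dom (KS_act X \<theta>) (s\<^sup>\<star> * s)))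
      (subtopology (KS_space X \<theta>) (act_dom (KS_act X \<theta>) (s * s\<^sup>\<star>))) (\<lambda>\<tau>. the (KS_act X \<theta> s \<tau>))"
    unfolding act_dom_KS_act[OF star_mult_idempotent] act_dom_KS_act[OF mult_star_idempotent]
    by (rule continuous_map_eq[OF continuous_map_KS_map[OF X]]) (simp add: KS_act_def)
next
  fix s t show "KS_act X \<theta> (s * t) = KS_act X \<theta> s \<circ>\<^sub>m KS_act X \<theta> t"
    by (rule KS_act_mult)
next
  fix e :: 's assume "e \<in> idempotents"
  then show "openin (KS_space X \<theta>) (act_dom (KS_act X \<theta>) e)"
    by (simp add: act_dom_KS_act openin_KS_dom)
next
  show "(\<Union>e\<in>idempotents. act_dom (KS_act X \<theta>) e) = topspace (KS_space X \<theta>)"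
    by (simp add: act_dom_KS_act topspace_KS_space_eq_Union)
qed

lemma KS_value_in_dom:
  assumes "\<tau> \<in> topspace (KS_space X \<theta>)" "e \<in> idempotents" "\<tau> (s\<^sup>\<star> * e * s) = Some x"
  shows "x \<in> dom (\<theta> (e * s))"
  using assms conj_idempotent[OF assms(2), of s]
  by (auto simp: topspace_KS_space KS_point_apply dom_act[of "e * s"] conj_star_mult filter_at_dom
      split: if_splits)

end

theorem theorem2p2p1:
  fixes X :: "'x topology"
    and \<theta> :: "'s::inverse_semigroup \<Rightarrow> ('x \<rightharpoonup> 'x)"
  assumes "locally_compact_space X" and "Hausdorff_space X"
    and "is_action X \<theta>"
  shows "(\<forall>e\<in>idempotents. openin (KS_space X \<theta>) (KS_dom X \<theta> e)) \<and>
    topspace (KS_space X \<theta>) = (\<Union>e\<in>idempotents. KS_dom X \<theta> e) \<and>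
    (\<forall>s. (\<forall>\<tau>\<in>KS_dom X \<theta> (s\<^sup>\<star> * s). \<forall>e\<in>idempotents. s\<^sup>\<star> * e * s \<in> idempotents \<and>
            (\<forall>x. \<tau> (s\<^sup>\<star> * e * s) = Some x \<longrightarrow> x \<in> dom (\<theta> (e * s)))) \<and>
         homeomorphic_map (subtopology (KS_space X \<theta>) (KS_dom X \<theta> (s\<^sup>\<star> * s)))
                          (subtopology (KS_space X \<theta>) (KS_dom X \<theta> (s * s\<^sup>\<star>)))
                          (KS_map \<theta> s)) \<and>
    is_action (KS_space X \<theta>) (KS_act X \<theta>)"
proof -
  interpret inverse_semigroup_action X \<theta>
    by unfold_locales (rule assms)
  have "\<tau> \<in> topspace (KS_space X \<theta>)" if "\<tau> \<in> KS_dom X \<theta> e" for \<tau> e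
    using that by (simp add: KS_dom_def)
  then show ?thesis
    using openin_KS_dom topspace_KS_space_eq_Union homeomorphic_map_KS_map[OF assms(1,2)]
      is_action_KS_act[OF assms(1,2)] conj_idempotent KS_value_in_dom
    by blast
qed

end
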